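(* Let $y_{\rm qc}\in\mathcal Y_{\rm qc}$ and let $z_\ell=(J_{\mathcal U_{\rm qc}}y_{\rm qc})(\ell\varepsilon)$, $\ell\in\mathbb Z$, be the vector of lattice values of $J_{\mathcal U_{\rm qc}}y_{\rm qc}$. If $\min_\ell z'_\ell\ge r_*/2$, then for all $\mathbf v\in\mathcal U^\varepsilon$ $$E_{\rm a}''(\mathbf z)[\mathbf v,\mathbf v]\ \ge\ A_*(\mathbf z)\,\varepsilon\sum_{\ell=1}^N|v'_\ell|^2,\qquad A_*(\mathbf z)=\min_{\ell=1,\dots,N}A_\ell(\mathbf z),$$ where $A_\ell(\mathbf z)=\phi''(z'_\ell)+2\phi''(z'_{\ell-1}+z'_\ell)+2\phi''(z'_\ell+z'_{\ell+1})$.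
   Context: $N\in\mathbb N$, $\varepsilon=1/N$, $F>0$. $\phi\in C^3((0,\infty))$ and $r_*>0$ is such that $\phi$ is convex on $(0,r_* )$ and concave on $(r_*,\infty)$. For a vector $\mathbf w\in\mathbb R^{\mathbb Z}$, $w'_\ell=(w_\ell-w_{\ell-1})/\varepsilon$. $\mathcal U^\varepsilon=\{\mathbf u\in\mathbb R^{\mathbb Z}:u_{\ell+N}=u_\ell,\ \varepsilon\sum_{\ell=1}^Nu_\ell=0\}$ and $\mathcal Y^\varepsilon=\{\mathbf y\in\mathbb R^{\mathbb Z}:y_\ell=F\ell\varepsilon+u_\ell,\ \mathbf u\in\mathcal U^\varepsilon\}$. $\mathcal T^h$ is a partition of $\mathbb R$ into closed intervals that is invariant under translation by $1$; $\mathcal U_{\rm qc}$ is the space of continuous, 1-periodic functions on $\mathbb R$ that are affine on each element of $\mathcal T^h$ and have zero mean over $[0,1]$; $\mathcal Y_{\rm qc}=\{Fx+u:u\in\mathcal U_{\rm qc}\}$. For $y_h=Fx+u_h\in\mathcal Y_{\rm qc}$, $J_{\mathcal U_{\rm qc}}y_h=Fx+I_\varepsilon u_h-\varepsilon\sum_{\ell=1}^Nu_h(\ell\varepsilon)$, with $I_\varepsilon$ the continuous piecewise affine interpolation at the points $\ell\varepsilon$; its lattice values form an element of $\mathcal Y^\varepsilon$. The atomistic energy of $\mathbf y\in\mathcal Y^\varepsilon$ with positive gradients is $E_{\rm a}(\mathbf y)=\varepsilon\sum_{\ell=1}^N\phi(y'_\ell)+\varepsilon\sum_{\ell=1}^N\phi(y'_{\ell-1}+y'_\ell)-\varepsilon\sum_{\ell=1}^Nf_\ell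 u_\ell$, where $\mathbf f\in\mathcal U^\varepsilon$ is a fixed load and $u_\ell=y_\ell-F\ell\varepsilon$; $E_{\rm a}''(\mathbf y)[\mathbf v,\mathbf v]=\varepsilon\sum_{\ell=1}^N\phi''(y'_\ell)|v'_\ell|^2+\varepsilon\sum_{\ell=1}^N\phi''(y'_\ell+y'_{\ell+1})|v'_\ell+v'_{\ell+1}|^2$ is its second variation. *)

theory Defs
  imports "HOL-Analysis.Analysis"
begin

section \<open>Potential\<close>

text \<open>
  \<open>C_k_on k f S\<close>: \<open>f\<close> is \<open>k\<close> times continuously differentiable on the open set \<open>S\<close>.
  Values of \<open>f\<close> outside \<open>S\<close> play no role, since \<^const>\<open>deriv\<close> is local.
\<close>

definition C_k_on :: "nat \<Rightarrow> (real \<Rightarrow> real) \<Rightarrow> real set \<Rightarrow> bool" where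
  "C_k_on k f S \<longleftrightarrow>
     (\<forall>j<k. \<forall>x\<in>S. (deriv ^^ j) f field_differentiable at x) \<and>
     continuous_on S ((deriv ^^ k) f)"


section \<open>Lattice functions\<close>

definition eps :: "nat \<Rightarrow> real" where
  "eps N = 1 / real N"

definition ddiff :: "nat \<Rightarrow> (int \<Rightarrow> real) \<Rightarrow> int \<Rightarrow> real" where
  "ddiff N w l = (w l - w (l - 1)) / eps N"

definition U_eps :: "nat \<Rightarrow> (int \<Rightarrow> real) set" where
  "U_eps N = {u. (\<forall>l. u (l + int N) = u l) \<and> eps N * (\<Sum>l=1..int N. u l) = 0}"

definition Y_eps :: "nat \<Rightarrow> real \<Rightarrow> (int \<Rightarrow> real) set" where
  "Y_eps N F = {y. \<exists>u\<in>U_eps N. \<forall>l. y l = F * of_int l * eps N + u l}"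


section \<open>Quasicontinuum space\<close>

text \<open>
  A partition of the line into closed intervals is understood in the finite element sense:
  distinct elements may share end points but not interior points.
\<close>

definition periodic_mesh :: "real set set \<Rightarrow> bool" where
  "periodic_mesh T \<longleftrightarrow>
     (\<forall>K\<in>T. \<exists>a b. a < b \<and> K = {a..b}) \<and>
     \<Union>T = UNIV \<and>
     (\<forall>K\<in>T. \<forall>L\<in>T. K \<noteq> L \<longrightarrow> interior K \<inter> interior L = {}) \<and>
     (\<lambda>K. (\<lambda>x. x + 1) ` K) ` T = T"

definition U_qc :: "real set set \<Rightarrow> (real \<Rightarrow> real) set" where
  "U_qc T = {u. continuous_on UNIV u \<and>
                (\<forall>x. u (x + 1) = u x) \<and>
                (\<forall>K\<in>T. \<exists>a b. \<forall>x\<in>K. u x = a * x + b) \<and>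
                integral {0..1} u = 0}"

definition Y_qc :: "real set set \<Rightarrow> real \<Rightarrow> (real \<Rightarrow> real) set" where
  "Y_qc T F = {y. \<exists>u\<in>U_qc T. \<forall>x. y x = F * x + u x}"

definition interp :: "nat \<Rightarrow> (real \<Rightarrow> real) \<Rightarrow> real \<Rightarrow> real" where
  "interp N u x =
     (let k = \<lfloor>x / eps N\<rfloor> in
       u (of_int k * eps N)
       + (x / eps N - of_int k) * (u (of_int (k + 1) * eps N) - u (of_int k * eps N)))"

text \<open>
  On each closed cell \<^const>\<open>interp\<close> is the affine function through the end point values;
  in particular it is continuous.
\<close>

lemma interp_on_cell:
  assumes "N > 0" and "of_int k * eps N \<le> x" and "x \<le> of_int (k + 1) * eps N"
  shows "interp N u x =
           u (of_int k * eps N)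
           + (x / eps N - of_int k) * (u (of_int (k + 1) * eps N) - u (of_int k * eps N))"
proof -
  have e: "eps N > 0" using assms(1) by (simp add: eps_def)
  have b: "of_int k \<le> x / eps N" "x / eps N \<le> of_int (k + 1)"
    using assms(2,3) e by (simp_all add: pos_le_divide_eq pos_divide_le_eq)
  show ?thesis
  proof (cases "x / eps N = of_int (k + 1)")
    case True
    then have "\<lfloor>x / eps N\<rfloor> = k + 1" by (metis floor_of_int)
    with True show ?thesis by (simp add: interp_def Let_def)
  next
    case False
    with b have "\<lfloor>x / eps N\<rfloor> = k" by (intro floor_unique) auto
    then show ?thesis by (simp add: interp_def Let_def)
  qed
qed

definition J_qc :: "nat \<Rightarrow> real \<Rightarrow> (real \<Rightarrow> real) \<Rightarrow> real \<Rightarrow> real" where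
  "J_qc N F y x =
     (let u = (\<lambda>s. y s - F * s) in
       F * x + interp N u x - eps N * (\<Sum>l=1..int N. u (of_int l * eps N)))"


lemma J_qc_lattice_in_Y_eps:
  assumes "N > 0" and "y \<in> Y_qc T F"
  shows "(\<lambda>l. J_qc N F y (of_int l * eps N)) \<in> Y_eps N F"
proof -
  obtain u where u: "u \<in> U_qc T" "\<And>x. y x = F * x + u x"
    using assms(2) by (auto simp: Y_qc_def)
  have e: "eps N > 0" "real N * eps N = 1" using assms(1) by (simp_all add: eps_def)
  define m where "m = eps N * (\<Sum>l=1..int N. u (of_int l * eps N))"
  define w where "w = (\<lambda>l. u (of_int l * eps N) - m)"
  have "interp N u (of_int l * eps N) = u (of_int l * eps N)" for l
    using e(1) by (simp add: interp_def)
  then have J: "J_qc N F y (of_int l * eps N) = F * of_int l * eps N + w l" for l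
    by (simp add: J_qc_def u(2) w_def m_def)
  have "u (of_int (l + int N) * eps N) = u (of_int l * eps N)" for l
  proof -
    have "of_int (l + int N) * eps N = of_int l * eps N + 1"
      using e(2) by (simp add: algebra_simps)
    then show ?thesis using u(1) by (simp add: U_qc_def)
  qed
  moreover have "eps N * (\<Sum>l=1..int N. w l) = m - (real N * eps N) * m"
    by (simp add: w_def m_def sum_subtractf right_diff_distrib)
  ultimately have "w \<in> U_eps N" using e(2) by (simp add: U_eps_def w_def)
  with J show ?thesis by (auto simp: Y_eps_def)
qed


section \<open>Atomistic energy\<close>

definition E_a ::
  "nat \<Rightarrow> real \<Rightarrow> (real \<Rightarrow> real) \<Rightarrow> (int \<Rightarrow> real) \<Rightarrow> (int \<Rightarrow> real) \<Rightarrow> real" where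
  "E_a N F \<phi> f y =
     eps N * (\<Sum>l=1..int N. \<phi> (ddiff N y l))
     + eps N * (\<Sum>l=1..int N. \<phi> (ddiff N y (l - 1) + ddiff N y l))
     - eps N * (\<Sum>l=1..int N. f l * (y l - F * of_int l * eps N))"

definition second_variation ::
  "((int \<Rightarrow> real) \<Rightarrow> real) \<Rightarrow> (int \<Rightarrow> real) \<Rightarrow> (int \<Rightarrow> real) \<Rightarrow> real" where
  "second_variation E y v = (deriv ^^ 2) (\<lambda>t. E (\<lambda>l. y l + t * v l)) 0"

lemma ddiff_periodic:
  assumes "\<And>l. v (l + int N) = v l"
  shows "ddiff N v (l + int N) = ddiff N v l"
  using assms[of l] assms[of "l - 1"] by (simp add: ddiff_def algebra_simps)

lemma ddiff_add_scale:
  "ddiff N (\<lambda>l. y l + t * v l) l = ddiff N y l + t * ddiff N v l"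
  by (simp add: ddiff_def diff_divide_distrib algebra_simps add_divide_distrib)

lemma ddiff_Y_eps_periodic:
  assumes "y \<in> Y_eps N F"
  shows "ddiff N y (l + int N) = ddiff N y l"
proof -
  obtain u where u: "u \<in> U_eps N" "\<And>l. y l = F * of_int l * eps N + u l"
    using assms by (auto simp: Y_eps_def)
  have p: "\<And>l. u (l + int N) = u l" using u(1) by (auto simp: U_eps_def)
  have "\<And>l. ddiff N y l = F * eps N / eps N + ddiff N u l"
    by (simp add: ddiff_def u(2) algebra_simps diff_divide_distrib add_divide_distrib)
  then show ?thesis using ddiff_periodic[of u N, OF p] by simp
qed

lemma sum_shift_periodic:
  fixes g :: "int \<Rightarrow> real"
  assumes "N > 0" and "\<And>l. g (l + int N) = g l"
  shows "(\<Sum>l=1..int N. g (l - 1)) = (\<Sum>l=1..int N. g l)"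
proof -
  have "(\<Sum>l=1..int N. g (l - 1)) = (\<Sum>l=0..int N - 1. g l)"
    by (rule sum.reindex_bij_witness[of _ "\<lambda>l. l + 1" "\<lambda>l. l - 1"]) auto
  also have "{0..int N - 1} = insert 0 {1..int N - 1}" using assms(1) by auto
  also have "sum g \<dots> = g (int N) + sum g {1..int N - 1}"
    using assms(2)[of 0] by simp
  also have "\<dots> = sum g (insert (int N) {1..int N - 1})" by simp
  also have "insert (int N) {1..int N - 1} = {1..int N}" using assms(1) by auto
  finally show ?thesis .
qed

text \<open>The second variation of the atomistic energy has the expected closed form.\<close>

lemma second_variation_E_a:
  assumes N: "N > 0" and C3: "C_k_on 3 \<phi> {0<..}"
    and y: "y \<in> Y_eps N F" and v: "v \<in> U_eps N"
    and pos: "\<And>l. ddiff N y l > 0"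
  shows "second_variation (E_a N F \<phi> f) y v =
           eps N * (\<Sum>l=1..int N. (deriv ^^ 2) \<phi> (ddiff N y l) * \<bar>ddiff N v l\<bar>\<^sup>2)
           + eps N * (\<Sum>l=1..int N. (deriv ^^ 2) \<phi> (ddiff N y l + ddiff N y (l + 1))
                                  * \<bar>ddiff N v l + ddiff N v (l + 1)\<bar>\<^sup>2)"
proof -
  define a where "a = ddiff N y"
  define b where "b = ddiff N v"
  have fd: "(deriv ^^ j) \<phi> field_differentiable at x" if "x > 0" "j < 3" for x j
    using C3 that by (auto simp: C_k_on_def)
  have d1: "(\<phi> has_field_derivative deriv \<phi> x) (at x)" if "x > 0" for x
    using fd[of x 0] that field_differentiable_derivI by fastforce
  have d2: "(deriv \<phi> has_field_derivative deriv (deriv \<phi>) x) (at x)" if "x > 0" for x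
    using fd[of x 1] that field_differentiable_derivI by fastforce
  define g where "g = (\<lambda>t. E_a N F \<phi> f (\<lambda>l. y l + t * v l))"
  define G where "G = (\<lambda>t. eps N * (\<Sum>l=1..int N. deriv \<phi> (a l + t * b l) * b l)
     + eps N * (\<Sum>l=1..int N. deriv \<phi> ((a (l - 1) + t * b (l - 1)) + (a l + t * b l))
                              * (b (l - 1) + b l))
     - eps N * (\<Sum>l=1..int N. f l * v l))"
  have g: "g = (\<lambda>t. eps N * (\<Sum>l=1..int N. \<phi> (a l + t * b l))
     + eps N * (\<Sum>l=1..int N. \<phi> ((a (l - 1) + t * b (l - 1)) + (a l + t * b l)))
     - eps N * (\<Sum>l=1..int N. f l * (y l + t * v l - F * of_int l * eps N)))"
    by (simp add: g_def E_a_def ddiff_add_scale a_def b_def)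
  have ev: "\<forall>\<^sub>F t in nhds 0. \<forall>l\<in>{0..int N}. 0 < a l + t * b l"
  proof (intro eventually_ball_finite ballI)
    fix l
    have "((\<lambda>t. a l + t * b l) \<longlongrightarrow> a l + 0 * b l) (nhds 0)"
      by (intro tendsto_intros filterlim_ident)
    then show "\<forall>\<^sub>F t in nhds 0. 0 < a l + t * b l"
      using pos[of l] by (intro order_tendstoD(1)) (auto simp: a_def)
  qed auto
  have dg: "(g has_field_derivative G t) (at t)"
    if t: "\<forall>l\<in>{0..int N}. 0 < a l + t * b l" for t
  proof -
    have p1: "((\<lambda>t. \<phi> (a l + t * b l)) has_field_derivative
               deriv \<phi> (a l + t * b l) * b l) (at t)" if "l \<in> {1..int N}" for l
      using t that by (intro DERIV_chain2[OF d1]) (auto intro!: derivative_eq_intros)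
    have p2: "((\<lambda>t. \<phi> ((a (l - 1) + t * b (l - 1)) + (a l + t * b l))) has_field_derivative
               deriv \<phi> ((a (l - 1) + t * b (l - 1)) + (a l + t * b l)) * (b (l - 1) + b l)) (at t)"
      if "l \<in> {1..int N}" for l
    proof (rule DERIV_chain2[OF d1])
      have "0 < a (l - 1) + t * b (l - 1)" "0 < a l + t * b l"
        using bspec[OF t, of "l - 1"] bspec[OF t, of l] that by auto
      then show "0 < a (l - 1) + t * b (l - 1) + (a l + t * b l)" by linarith
    qed (auto intro!: derivative_eq_intros)
    have p3: "((\<lambda>t. f l * (y l + t * v l - F * of_int l * eps N)) has_field_derivative
               f l * v l) (at t)" for l
      by (auto intro!: derivative_eq_intros)
    show ?thesis unfolding g G_def
      by (intro DERIV_diff DERIV_add DERIV_cmult DERIV_sum p1 p2 p3) auto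
  qed
  have evG: "\<forall>\<^sub>F t in nhds 0. deriv g t = G t"
    using ev by eventually_elim (use dg DERIV_imp_deriv in blast)
  have p1: "((\<lambda>t. deriv \<phi> (a l + t * b l) * b l) has_field_derivative
               deriv (deriv \<phi>) (a l) * b l * b l) (at 0)" for l
  proof (rule DERIV_cmult_right, rule DERIV_chain2[where x = 0 and g = "\<lambda>t. a l + t * b l"])
    show "(deriv \<phi> has_field_derivative deriv (deriv \<phi>) (a l)) (at (a l + 0 * b l))"
      using d2[of "a l"] pos[of l] by (simp add: a_def)
  qed (auto intro!: derivative_eq_intros)
  have p2: "((\<lambda>t. deriv \<phi> ((a (l - 1) + t * b (l - 1)) + (a l + t * b l)) * (b (l - 1) + b l))
             has_field_derivative
               deriv (deriv \<phi>) (a (l - 1) + a l) * (b (l - 1) + b l) * (b (l - 1) + b l)) (at 0)" for l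
  proof (rule DERIV_cmult_right, rule DERIV_chain2[where x = 0 and
      g = "\<lambda>t. (a (l - 1) + t * b (l - 1)) + (a l + t * b l)"])
    show "(deriv \<phi> has_field_derivative deriv (deriv \<phi>) (a (l - 1) + a l))
           (at (a (l - 1) + 0 * b (l - 1) + (a l + 0 * b l)))"
      using d2[of "a (l - 1) + a l"] pos[of l] pos[of "l - 1"] by (simp add: a_def)
  qed (auto intro!: derivative_eq_intros)
  have "(G has_field_derivative
      eps N * (\<Sum>l=1..int N. deriv (deriv \<phi>) (a l) * b l * b l)
      + eps N * (\<Sum>l=1..int N. deriv (deriv \<phi>) (a (l - 1) + a l) * (b (l - 1) + b l) * (b (l - 1) + b l))
      - 0) (at 0)"
    unfolding G_def by (intro DERIV_diff DERIV_add DERIV_cmult DERIV_sum p1 p2 DERIV_const)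
  then have "deriv G 0 =
      eps N * (\<Sum>l=1..int N. deriv (deriv \<phi>) (a l) * b l * b l)
      + eps N * (\<Sum>l=1..int N. deriv (deriv \<phi>) (a (l - 1) + a l) * (b (l - 1) + b l) * (b (l - 1) + b l))"
    by (simp add: DERIV_imp_deriv)
  moreover have "second_variation (E_a N F \<phi> f) y v = deriv G 0"
    using deriv_cong_ev[OF evG refl]
    by (simp add: second_variation_def g_def numeral_2_eq_2)
  moreover have
    "(\<Sum>l=1..int N. deriv (deriv \<phi>) (a (l - 1) + a l) * (b (l - 1) + b l) * (b (l - 1) + b l))
     = (\<Sum>l=1..int N. deriv (deriv \<phi>) (a l + a (l + 1)) * (b l + b (l + 1)) * (b l + b (l + 1)))"
  proof -
    have pa: "a (l + int N) = a l" for l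
      unfolding a_def by (rule ddiff_Y_eps_periodic[OF y])
    have pb: "b (l + int N) = b l" for l
      unfolding b_def using v by (intro ddiff_periodic) (auto simp: U_eps_def)
    have "a (l + int N + 1) = a (l + 1)" "b (l + int N + 1) = b (l + 1)" for l
      using pa[of "l + 1"] pb[of "l + 1"] by (simp_all add: ac_simps)
    then show ?thesis
      using sum_shift_periodic[OF N, of "\<lambda>l. deriv (deriv \<phi>) (a l + a (l + 1))
        * (b l + b (l + 1)) * (b l + b (l + 1))"] pa pb
      by simp
  qed
  ultimately show ?thesis
    by (simp add: a_def b_def numeral_2_eq_2 mult.assoc)
qed


section \<open>Stability constant\<close>

definition A_coeff :: "nat \<Rightarrow> (real \<Rightarrow> real) \<Rightarrow> (int \<Rightarrow> real) \<Rightarrow> int \<Rightarrow> real" where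
  "A_coeff N \<phi> z l =
     (deriv ^^ 2) \<phi> (ddiff N z l)
     + 2 * (deriv ^^ 2) \<phi> (ddiff N z (l - 1) + ddiff N z l)
     + 2 * (deriv ^^ 2) \<phi> (ddiff N z l + ddiff N z (l + 1))"

definition A_star :: "nat \<Rightarrow> (real \<Rightarrow> real) \<Rightarrow> (int \<Rightarrow> real) \<Rightarrow> real" where
  "A_star N \<phi> z = (MIN l\<in>{1..int N}. A_coeff N \<phi> z l)"

end

theory Submission
  imports Defs
begin

text \<open>
  Since \<open>z'\<^sub>\<ell> \<ge> r\<^sub>*/2\<close>, every next-nearest-neighbour strain \<open>z'\<^sub>\<ell> + z'\<^sub>\<ell>\<^sub>+\<^sub>1\<close> lies in the
  concave range of \<open>\<phi>\<close>, so its coefficient \<open>\<phi>''\<close> is nonpositive. Estimating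
  \<open>\<bar>v'\<^sub>\<ell> + v'\<^sub>\<ell>\<^sub>+\<^sub>1\<bar>\<^sup>2 \<le> 2\<bar>v'\<^sub>\<ell>\<bar>\<^sup>2 + 2\<bar>v'\<^sub>\<ell>\<^sub>+\<^sub>1\<bar>\<^sup>2\<close> therefore bounds the second variation from below by a
  diagonal form, and shifting the index by periodicity identifies its coefficients as \<open>A\<^sub>\<ell>\<close>.
\<close>

text \<open>A convex function lies above its tangents. Adding the tangent inequalities at
  \<open>x\<close> and at \<open>y\<close> cancels the values of \<open>g\<close> and leaves
  \<open>(g' y - g' x) * (y - x)\<close> nonnegative.\<close>

lemma convex_on_imp_deriv_mono:
  fixes g g' :: "real \<Rightarrow> real"
  assumes "convex_on S g" and "open S"
    and "\<And>x. x \<in> S \<Longrightarrow> (g has_real_derivative g' x) (at x)"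
  shows "mono_on S g'"
proof (rule mono_onI)
  fix x y assume xy: "x \<in> S" "y \<in> S" "x \<le> y"
  have S: "connected S" "interior S = S"
    using assms(1,2) convex_on_imp_convex convex_connected interior_open by blast+
  have tangent: "g' c * (u - c) \<le> g u - g c" if "c \<in> S" "u \<in> S" for c u
    using convex_on_imp_above_tangent[OF assms(1) S(1), of c u "g' c"] assms(3)[of c] that S(2)
      has_field_derivative_at_within by blast
  have "g' x * (y - x) \<le> g' y * (y - x)"
    using tangent[OF xy(1,2)] tangent[OF xy(2,1)] by (simp add: algebra_simps)
  then show "g' x \<le> g' y"
    using xy(3) by (cases "x = y") (auto simp: mult_le_cancel_right)
qed

text \<open>Passing to \<open>- g\<close> makes \<open>- g'\<close> monotone on \<open>S\<close>, so
  its derivative \<open>- D\<close> at the interior point \<open>x\<close> is nonnegative.\<close>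

lemma concave_on_imp_second_deriv_nonpos:
  fixes g g' :: "real \<Rightarrow> real"
  assumes "concave_on S g" and "open S" and "x \<in> S"
    and "\<And>x. x \<in> S \<Longrightarrow> (g has_real_derivative g' x) (at x)"
    and "(g' has_real_derivative D) (at x)"
  shows "D \<le> 0"
proof -
  have "mono_on S (\<lambda>x. - g' x)"
    using assms(1,2,4) unfolding concave_on_def
    by (intro convex_on_imp_deriv_mono[of S "\<lambda>x. - g x"]) (auto intro: DERIV_minus)
  then have "0 \<le> - D"
    using assms(2,3,5)
    by (intro mono_on_imp_deriv_nonneg[of S "\<lambda>x. - g' x" "- D" x])
       (auto intro: DERIV_minus simp: interior_open)
  then show ?thesis by simp
qed

text \<open>Concavity gives the sign on the open half-line only; continuity of the second derivative
  carries it to the endpoint \<open>r\<close>, which is attained when two neighbouring strains both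
  equal \<open>r / 2\<close>.\<close>

lemma C_k_on_concave_second_deriv_nonpos:
  assumes C: "C_k_on k \<phi> {0<..}" "k \<ge> 3" and r: "r > 0" and conc: "concave_on {r<..} \<phi>"
    and x: "x \<ge> r"
  shows "(deriv ^^ 2) \<phi> x \<le> 0"
proof (rule continuous_le_on_closure[of "{r<..}" "(deriv ^^ 2) \<phi>" x])
  have fd: "(deriv ^^ j) \<phi> field_differentiable at t" if "t > 0" "j < 3" for t j
    using C that by (auto simp: C_k_on_def)
  have d1: "(\<phi> has_field_derivative deriv \<phi> t) (at t)" if "t > 0" for t
    using fd[of t 0] that field_differentiable_derivI by fastforce
  have d2: "(deriv \<phi> has_field_derivative (deriv ^^ 2) \<phi> t) (at t)" if "t > 0" for t
    using fd[of t 1] that field_differentiable_derivI by (fastforce simp: numeral_2_eq_2)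
  \<comment> \<open>Since \<open>r > 0\<close>, the closure stays inside the domain of \<phi>, where
    the second derivative is itself differentiable.\<close>
  show "continuous_on (closure {r<..}) ((deriv ^^ 2) \<phi>)"
    using fd[of _ 2] r
    by (auto intro!: continuous_at_imp_continuous_on field_differentiable_imp_continuous_at)
  show "x \<in> closure {r<..}" using x by simp
  show "(deriv ^^ 2) \<phi> t \<le> 0" if "t \<in> {r<..}" for t
    using concave_on_imp_second_deriv_nonpos[OF conc _ that, of "deriv \<phi>"] d1 d2 that r by auto
qed

text \<open>The bound for the pair \<open>l\<close>, \<open>l + 1\<close> is split evenly between
  its members, so index \<open>l\<close> collects \<open>2 * c (l - 1)\<close> from the left pair
  and \<open>2 * c l\<close> from the right one.\<close>

lemma periodic_quadratic_form_lower_bound: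
  fixes p c b :: "int \<Rightarrow> real"
  assumes N: "N > 0" and c: "\<And>l. c (l + int N) = c l" and b: "\<And>l. b (l + int N) = b l"
    and neg: "\<And>l. c l \<le> 0"
  shows "(\<Sum>l=1..int N. (p l + 2 * c (l - 1) + 2 * c l) * (b l)\<^sup>2)
           \<le> (\<Sum>l=1..int N. p l * (b l)\<^sup>2) + (\<Sum>l=1..int N. c l * (b l + b (l + 1))\<^sup>2)"
proof -
  have "b (l + int N + 1) = b (l + 1)" for l
    using b[of "l + 1"] by (simp add: ac_simps)
  then have shift: "(\<Sum>l=1..int N. c (l - 1) * (b l)\<^sup>2) = (\<Sum>l=1..int N. c l * (b (l + 1))\<^sup>2)"
    using sum_shift_periodic[OF N, of "\<lambda>l. c l * (b (l + 1))\<^sup>2"] c by simp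
  have "c l * (2 * (b l)\<^sup>2 + 2 * (b (l + 1))\<^sup>2) \<le> c l * (b l + b (l + 1))\<^sup>2" for l
  proof (rule mult_left_mono_neg[OF _ neg])
    \<comment> \<open>The right side exceeds the left by exactly
      \<open>(b l - b (l + 1))\<^sup>2\<close>.\<close>
    show "(b l + b (l + 1))\<^sup>2 \<le> 2 * (b l)\<^sup>2 + 2 * (b (l + 1))\<^sup>2"
      using zero_le_power2[of "b l - b (l + 1)"] by (simp add: power2_eq_square algebra_simps)
  qed
  then have "(\<Sum>l=1..int N. c l * (2 * (b l)\<^sup>2 + 2 * (b (l + 1))\<^sup>2))
               \<le> (\<Sum>l=1..int N. c l * (b l + b (l + 1))\<^sup>2)"
    by (rule sum_mono)
  moreover have "(\<Sum>l=1..int N. c l * (2 * (b l)\<^sup>2 + 2 * (b (l + 1))\<^sup>2))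
      = 2 * (\<Sum>l=1..int N. c l * (b l)\<^sup>2) + 2 * (\<Sum>l=1..int N. c (l - 1) * (b l)\<^sup>2)"
    unfolding shift by (simp add: sum_distrib_left sum.distrib algebra_simps)
  moreover have "(\<Sum>l=1..int N. (p l + 2 * c (l - 1) + 2 * c l) * (b l)\<^sup>2)
      = (\<Sum>l=1..int N. p l * (b l)\<^sup>2) + 2 * (\<Sum>l=1..int N. c (l - 1) * (b l)\<^sup>2)
        + 2 * (\<Sum>l=1..int N. c l * (b l)\<^sup>2)"
    by (simp add: sum_distrib_left sum.distrib algebra_simps)
  ultimately show ?thesis by linarith
qed

theorem lemma6:
  fixes N :: nat and F r :: real and \<phi> :: "real \<Rightarrow> real"
    and f z :: "int \<Rightarrow> real" and T :: "real set set" and y_qc :: "real \<Rightarrow> real"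
  assumes "N \<ge> 1" and "F > 0"
    and "C_k_on 3 \<phi> {0<..}"
    and "r > 0" and "convex_on {0<..<r} \<phi>" and "concave_on {r<..} \<phi>"
    and "f \<in> U_eps N"
    and "periodic_mesh T"
    and "y_qc \<in> Y_qc T F"
    and "z = (\<lambda>l. J_qc N F y_qc (of_int l * eps N))"
    and "\<forall>l. ddiff N z l \<ge> r / 2"
  shows "\<forall>v\<in>U_eps N.
           second_variation (E_a N F \<phi> f) z v
             \<ge> A_star N \<phi> z * (eps N * (\<Sum>l=1..int N. \<bar>ddiff N v l\<bar>\<^sup>2))"
proof
  fix v assume v: "v \<in> U_eps N"
  have N: "N > 0" using assms(1) by simp
  have zY: "z \<in> Y_eps N F"
    unfolding assms(10) by (rule J_qc_lattice_in_Y_eps[OF N assms(9)])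
  have zr: "r / 2 \<le> ddiff N z l" for l using assms(11) by blast
  \<comment> \<open>Positive strains keep small perturbations of \<open>z\<close> where \<phi> is
    smooth, as the closed form of the second variation requires.\<close>
  have pos: "0 < ddiff N z l" for l using zr[of l] assms(4) by linarith
  define p where "p = (\<lambda>l. (deriv ^^ 2) \<phi> (ddiff N z l))"
  define c where "c = (\<lambda>l. (deriv ^^ 2) \<phi> (ddiff N z l + ddiff N z (l + 1)))"
  define b where "b = ddiff N v"
  have zper: "ddiff N z (l + int N) = ddiff N z l" for l
    by (rule ddiff_Y_eps_periodic[OF zY])
  have cper: "c (l + int N) = c l" for l
    using zper[of l] zper[of "l + 1"] by (simp add: c_def ac_simps)
  have bper: "b (l + int N) = b l" for l
    unfolding b_def using v by (intro ddiff_periodic) (auto simp: U_eps_def)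
  have neg: "c l \<le> 0" for l
    unfolding c_def using zr[of l] zr[of "l + 1"]
    by (intro C_k_on_concave_second_deriv_nonpos[OF assms(3) _ assms(4,6)]) auto
  have A: "A_coeff N \<phi> z l = p l + 2 * c (l - 1) + 2 * c l" for l
    by (simp add: A_coeff_def p_def c_def)
  \<comment> \<open>The minimum bounds each coefficient from below, and the weights are squares; the
    sign of \<open>A_star\<close> is immaterial.\<close>
  have "A_star N \<phi> z * (\<Sum>l=1..int N. (b l)\<^sup>2) \<le> (\<Sum>l=1..int N. A_coeff N \<phi> z l * (b l)\<^sup>2)"
    unfolding sum_distrib_left by (intro sum_mono mult_right_mono) (auto simp: A_star_def)
  also have "\<dots> \<le> (\<Sum>l=1..int N. p l * (b l)\<^sup>2) + (\<Sum>l=1..int N. c l * (b l + b (l + 1))\<^sup>2)"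
    unfolding A by (rule periodic_quadratic_form_lower_bound[of N c b p, OF N cper bper neg])
  finally have "eps N * (A_star N \<phi> z * (\<Sum>l=1..int N. (b l)\<^sup>2))
      \<le> eps N * ((\<Sum>l=1..int N. p l * (b l)\<^sup>2) + (\<Sum>l=1..int N. c l * (b l + b (l + 1))\<^sup>2))"
    by (rule mult_left_mono) (simp add: eps_def)
  then show "A_star N \<phi> z * (eps N * (\<Sum>l=1..int N. \<bar>ddiff N v l\<bar>\<^sup>2))
      \<le> second_variation (E_a N F \<phi> f) z v"
    unfolding second_variation_E_a[OF N assms(3) zY v pos]
    by (simp add: p_def c_def b_def algebra_simps)
qed

end
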